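(* Under the quantization scheme $\mathcal{Q}_{\mathrm{a}}$ described in the context, the quantized primal-dual algorithm converges exponentially to the optimal solution of the problem: maximize $\sum_{i=1}^MU_i(x^i)$ subject to $A\boldsymbol{x}=\boldsymbol{b}$. That is, for every realization of the initial condition there exist constants $c>0$ and $r\in(0,1)$ such that $\|\boldsymbol{y}_k-\boldsymbol{y}^\star\|\le c\,r^k$ for all $k\ge0$.
   Context: **Problem.** Let $N<M$ be positive integers, $A\in\mathbb{R}^{N\times M}$, $\boldsymbol{b}\in\mathbb{R}^N$, $U_i:\mathbb{R}\to\mathbb{R}$ ($1\le i\le M$). Consider: maximize $\sum_{i=1}^M U_i(x^i)$ subject to $A\boldsymbol{x}=\boldsymbol{b}$. $\boldsymbol{y}^\star$ is the concatenation of the optimal primal and dual solutions $\boldsymbol{x}^\star,\boldsymbol{\lambda}^\star$. $A_i$ is the $i$th column of $A$, $\bar A_j$ its $j$th row. Assume: each $U_i$ is concave and twice continuously differentiable with $U_i^{\min}\le U_i''(x)\le U_i^{\max}<0$ for all $x$; $0<\mu_k\le\min_i1/|U_i^{\min}|$ for all $k$; $\mu_k\to\mu^\star>0$. **Unquantized primal-dual (PD) algorithm.** $x^i_k=x^i_{k-1}+\mu_{k-1}(U_i'(x^i_{k-1})-A_i^\top\boldsymbol{\lambda}_{k-1})$, $\lambda^j_k=\lambda^j_{k-1}+\mu_{k-1}(\bar A_j\boldsymbol{x}_{k-1}-b_j)$. It is assumed that this forms a contraction: there are a norm $\|\cdot\|$ on $\mathbb{R}^{M+N}$ and $\alpha\in(0,1)$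 such that each one-step update map $(\boldsymbol{x}_{k-1},\boldsymbol{\lambda}_{k-1})\mapsto(\boldsymbol{x}_k,\boldsymbol{\lambda}_k)$ is a contraction with constant $\alpha$ in $\|\cdot\|$. **Quantized algorithm under $\mathcal{Q}_{\mathrm{a}}$.** For $k\ge1$, $$x^i_k=x^i_{k-1}+\mu_{k-1}\left(U_i'(x^i_{k-1})-A_i^\top Q^{\boldsymbol{\lambda}}_{k-1}\right),\qquad \lambda^j_k=\lambda^j_{k-1}+\mu_{k-1}\left(\bar A_jQ^{\boldsymbol{x}}_{k-1}-b_j\right),$$ $\boldsymbol{y}_k$ is the concatenation of $\boldsymbol{x}_k,\boldsymbol{\lambda}_k$, and the entries of $Q^{\boldsymbol{x}}_k$, $Q^{\boldsymbol{\lambda}}_k$ are $\mathrm{Q}_{\mathrm{a},k}(x^i_k)$, $\mathrm{Q}_{\mathrm{a},k}(\lambda^j_k)$, defined as follows. Let $\delta_k=\alpha^{k+1}$, $m=\lceil 2/\alpha\rceil$, $L$ a positive integer. *Time 0.* Each $x^i_0$ and $\lambda^j_0$ is drawn uniformly from $(-L\alpha,L\alpha)$, and $\mathrm{Q}_{\mathrm{a},0}(z)=\lfloor z/\alpha\rfloor\alpha+\alpha/2$. *Time $k+1$, $k\ge0$.* For $v$ any one of the scalar variables $x^i$ or $\lambda^j$, let $$C^v_{k+1}=\mathrm{Q}_{\mathrm{a},k}(v_k)+\left\lfloor\frac{v_{k+1}-v_k}{\delta_k}\right\rfloor\delta_k .$$ The integer $\lfloor (v_{k+1}-v_k)/\delta_k\rfloor$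 is transmitted, so $C^v_{k+1}$ is known to the receivers; $v_{k+1}$ lies in the interval centered at $C^v_{k+1}$ of length $2m\delta_{k+1}$. Then $\hat{\mathrm{Q}}\left((v_{k+1}-C^v_{k+1})/\delta_{k+1}\right)$ is transmitted, where $\hat{\mathrm{Q}}(z)=\lfloor z\rfloor$ for $-m\le z< m-1$ and $\hat{\mathrm{Q}}(z)=m-1$ for $m-1\le z\le m$, and the quantized value is $$\mathrm{Q}_{\mathrm{a},k+1}(v_{k+1})=C^v_{k+1}+\hat{\mathrm{Q}}\left(\frac{v_{k+1}-C^v_{k+1}}{\delta_{k+1}}\right)\delta_{k+1}+\frac{\delta_{k+1}}{2}.$$ *)

theory Defs
  imports "HOL-Analysis.Analysis"
begin

definition is_norm :: "('a::real_vector \<Rightarrow> real) \<Rightarrow> bool" where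
  "is_norm nrm \<longleftrightarrow>
     (\<forall>v. nrm v = 0 \<longleftrightarrow> v = 0) \<and>
     (\<forall>c v. nrm (c *\<^sub>R v) = \<bar>c\<bar> * nrm v) \<and>
     (\<forall>v w. nrm (v + w) \<le> nrm v + nrm w)"

definition twice_continuously_differentiable :: "(real \<Rightarrow> real) \<Rightarrow> bool" where
  "twice_continuously_differentiable f \<longleftrightarrow>
     (\<forall>x. f differentiable (at x)) \<and>
     (\<forall>x. deriv f differentiable (at x)) \<and>
     continuous_on UNIV (deriv (deriv f))"

subsection \<open>The optimization problem and its Lagrangian dual\<close>

definition objective :: "('m::finite \<Rightarrow> real \<Rightarrow> real) \<Rightarrow> real^'m \<Rightarrow> real" where
  "objective U x = (\<Sum>i\<in>UNIV. U i (x $ i))"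

definition lagrangian ::
    "real^'m^'n \<Rightarrow> real^'n \<Rightarrow> ('m::finite \<Rightarrow> real \<Rightarrow> real) \<Rightarrow> real^'m \<Rightarrow> real^'n \<Rightarrow> real" where
  "lagrangian A b U x l = objective U x - l \<bullet> (A *v x - b)"

definition dual_function ::
    "real^'m^'n \<Rightarrow> real^'n \<Rightarrow> ('m::finite \<Rightarrow> real \<Rightarrow> real) \<Rightarrow> real^'n \<Rightarrow> ereal" where
  "dual_function A b U l = (SUP x. ereal (lagrangian A b U x l))"

definition primal_optimal ::
    "real^'m^'n \<Rightarrow> real^'n \<Rightarrow> ('m::finite \<Rightarrow> real \<Rightarrow> real) \<Rightarrow> real^'m \<Rightarrow> bool" where
  "primal_optimal A b U x \<longleftrightarrow> is_arg_max (objective U) (\<lambda>z. A *v z = b) x"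

definition dual_optimal ::
    "real^'m^'n \<Rightarrow> real^'n \<Rightarrow> ('m::finite \<Rightarrow> real \<Rightarrow> real) \<Rightarrow> real^'n \<Rightarrow> bool" where
  "dual_optimal A b U l \<longleftrightarrow> is_arg_min (dual_function A b U) (\<lambda>_. True) l"

subsection \<open>Primal-dual updates\<close>

text \<open>The primal update sees only the (possibly quantized) multipliers \<open>ql\<close> and the dual
  update only the (possibly quantized) primal variables \<open>qx\<close>, whereas each scalar variable is
  updated from its own exact value.\<close>

definition primal_update ::
    "real^'m^'n \<Rightarrow> ('m::finite \<Rightarrow> real \<Rightarrow> real) \<Rightarrow> real \<Rightarrow> real^'m \<Rightarrow> real^'n \<Rightarrow> real^'m" where
  "primal_update A U \<mu> x ql =
     (\<chi> i. x $ i + \<mu> * (deriv (U i) (x $ i) - column i A \<bullet> ql))"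

definition dual_update ::
    "real^'m^'n \<Rightarrow> real^'n \<Rightarrow> real \<Rightarrow> real^'n \<Rightarrow> real^'m \<Rightarrow> real^'n" where
  "dual_update A b \<mu> l qx = (\<chi> j. l $ j + \<mu> * (row j A \<bullet> qx - b $ j))"

definition pd_step ::
    "real^'m^'n \<Rightarrow> real^'n \<Rightarrow> ('m::finite \<Rightarrow> real \<Rightarrow> real) \<Rightarrow> real
       \<Rightarrow> (real^'m) \<times> (real^'n) \<Rightarrow> (real^'m) \<times> (real^'n)" where
  "pd_step A b U \<mu> y =
     (primal_update A U \<mu> (fst y) (snd y), dual_update A b \<mu> (snd y) (fst y))"

subsection \<open>The adaptive quantizer\<close>

definition delta :: "real \<Rightarrow> nat \<Rightarrow> real" where
  "delta \<alpha> k = \<alpha> ^ (k + 1)"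

text \<open>The value is left unspecified outside the domain \<open>[-m, m]\<close> of the quantizer.\<close>

definition Q_hat :: "int \<Rightarrow> real \<Rightarrow> int" where
  "Q_hat m z =
     (if - real_of_int m \<le> z \<and> z < real_of_int m - 1 then \<lfloor>z\<rfloor>
      else if real_of_int m - 1 \<le> z \<and> z \<le> real_of_int m then m - 1
      else undefined)"

definition Qa_center :: "real \<Rightarrow> nat \<Rightarrow> real \<Rightarrow> real \<Rightarrow> real \<Rightarrow> real" where
  "Qa_center \<alpha> k q v v' = q + of_int \<lfloor>(v' - v) / delta \<alpha> k\<rfloor> * delta \<alpha> k"

text \<open>The quantizer has memory: \<open>Qa \<alpha> v k\<close> is the quantized value at time \<open>k\<close> of a scalar
  variable whose trajectory is \<open>v\<close>. It depends only on \<open>v 0, \<dots>, v k\<close>.\<close>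

primrec Qa :: "real \<Rightarrow> (nat \<Rightarrow> real) \<Rightarrow> nat \<Rightarrow> real" where
  "Qa \<alpha> v 0 = of_int \<lfloor>v 0 / \<alpha>\<rfloor> * \<alpha> + \<alpha> / 2"
| "Qa \<alpha> v (Suc k) =
     (let C = Qa_center \<alpha> k (Qa \<alpha> v k) (v k) (v (Suc k))
      in C + of_int (Q_hat \<lceil>2 / \<alpha>\<rceil> ((v (Suc k) - C) / delta \<alpha> (Suc k))) * delta \<alpha> (Suc k)
           + delta \<alpha> (Suc k) / 2)"

definition Qa_vec :: "real \<Rightarrow> (nat \<Rightarrow> real^'d) \<Rightarrow> nat \<Rightarrow> real^'d" where
  "Qa_vec \<alpha> w k = (\<chi> i. Qa \<alpha> (\<lambda>t. w t $ i) k)"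

end

theory Submission
  imports Defs
begin

text \<open>
  Quantization preserves exponential convergence because the quantizer is refined at the rate
  at which the exact iteration contracts. The proof rests on three facts.

  First, the error of the quantizer at time \<open>k\<close> is at most \<open>\<alpha> ^ (k + 1) / 2\<close> along every
  trajectory (\<open>Qa_error\<close>). The innovation \<open>v (Suc k) - v k\<close> is transmitted without any
  range restriction, up to one cell of width \<open>\<alpha> ^ (k + 1)\<close>, so the uncertainty that is left has the
  order of \<open>\<alpha> ^ (k + 1)\<close>; the \<open>2 * m\<close> cells with \<open>m = \<lceil>2 / \<alpha>\<rceil>\<close> resolve it at the next,
  finer scale \<open>\<alpha> ^ (k + 2)\<close>. So the quantizer never saturates, whatever the iterates do.

  Second, a primal-dual optimal pair \<open>y\<^sup>*\<close> is a fixed point of every exact update map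
  \<open>T k\<close> (\<open>pd_step_fixed_point\<close>). A fixed point is a pair satisfying the first-order conditions
  \<open>A x = b\<close> and \<open>\<nabla>U x = A\<^sup>T \<lambda>\<close>. A multiplier exists at the primal optimum because the gradient of
  the objective is orthogonal to the kernel of \<open>A\<close>; by concavity it closes the duality gap. Hence
  the dual optimum closes it too, that is, \<open>x\<^sup>*\<close> maximizes the Lagrangian at \<open>\<lambda>\<^sup>*\<close>, and stationarity
  follows.

  Third, since the updates are affine in the quantized arguments, the quantized iteration is
  \<open>y (Suc k) = T k (y k) + \<mu> k * G d\<close>, where \<open>G\<close> is a fixed linear map and \<open>d\<close> is the vector of
  quantization errors. So the distance \<open>a k\<close> to the optimum, in the norm of the contraction, obeys
  \<open>a (Suc k) \<le> \<alpha> * a k + C * \<alpha> ^ (k + 1)\<close>. Contraction and perturbation decay at the same rate, which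
  gives \<open>k * \<alpha> ^ k\<close> and therefore exponential decay at every rate strictly between \<open>\<alpha>\<close> and \<open>1\<close>
  (\<open>perturbed_contraction_exponential\<close>).
\<close>

section \<open>Optimal pairs as fixed points of the exact iteration\<close>

definition gradient :: "('m::finite \<Rightarrow> real \<Rightarrow> real) \<Rightarrow> real^'m \<Rightarrow> real^'m" where
  "gradient U x = (\<chi> i. deriv (U i) (x $ i))"

lemma objective_has_directional_derivative:
  fixes x v :: "real^'m"
  assumes "\<And>i t. U i differentiable (at t)"
  shows "((\<lambda>t. objective U (x + t *\<^sub>R v)) has_real_derivative gradient U x \<bullet> v) (at 0)"
proof -
  have "((\<lambda>t. U i (x $ i + t * v $ i)) has_real_derivative deriv (U i) (x $ i) * v $ i) (at 0)"
    for i
  proof -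
    have U: "(U i has_real_derivative deriv (U i) (x $ i)) (at (x $ i + 0 * v $ i))"
      using assms[of i "x $ i"] by (simp add: DERIV_deriv_iff_real_differentiable)
    have line: "((\<lambda>t. x $ i + t * v $ i) has_real_derivative v $ i) (at 0)"
      by (auto intro!: derivative_eq_intros)
    show ?thesis
      using DERIV_chain2[where f = "U i" and g = "\<lambda>t. x $ i + t * v $ i", OF U line] .
  qed
  then have "((\<lambda>t. \<Sum>i\<in>UNIV. U i (x $ i + t * v $ i))
      has_real_derivative (\<Sum>i\<in>UNIV. deriv (U i) (x $ i) * v $ i)) (at 0)"
    by (intro DERIV_sum)
  then show ?thesis
    by (simp add: objective_def gradient_def inner_vec_def)
qed

lemma objective_le_tangent:
  fixes x z :: "real^'m"
  assumes concave: "\<And>i. concave_on UNIV (U i)"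
    and diff: "\<And>i t. U i differentiable (at t)"
  shows "objective U z \<le> objective U x + gradient U x \<bullet> (z - x)"
proof -
  have "U i (z $ i) \<le> U i (x $ i) + deriv (U i) (x $ i) * (z $ i - x $ i)" for i
  proof -
    have "((\<lambda>t. - U i t) has_real_derivative - deriv (U i) (x $ i)) (at (x $ i) within UNIV)"
      using diff[of i "x $ i"]
      by (auto intro!: derivative_eq_intros simp: DERIV_deriv_iff_real_differentiable)
    then have "- deriv (U i) (x $ i) * (z $ i - x $ i) \<le> - U i (z $ i) - (- U i (x $ i))"
      using concave[of i] unfolding concave_on_def
      by (intro convex_on_imp_above_tangent[where A = UNIV]) auto
    then show ?thesis by simp
  qed
  then have "objective U z
      \<le> (\<Sum>i\<in>UNIV. U i (x $ i) + deriv (U i) (x $ i) * (z $ i - x $ i))"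
    unfolding objective_def by (intro sum_mono)
  then show ?thesis
    by (simp add: objective_def gradient_def inner_vec_def sum.distrib)
qed

lemma inner_matrix_vector_transpose:
  fixes A :: "real^'m^'n"
  shows "l \<bullet> (A *v x) = (transpose A *v l) \<bullet> x"
  by (metis dot_lmul_matrix transpose_matrix_vector)

text \<open>The gradient splits into a part in the range of \<open>A\<^sup>T\<close> and a part in its orthogonal
  complement, the kernel of \<open>A\<close>. The second part is a feasible direction, along which the objective
  would increase unless it vanishes.\<close>

lemma lagrange_multiplier_exists:
  fixes A :: "real^'m^'n"
  assumes diff: "\<And>i t. U i differentiable (at t)"
    and opt: "primal_optimal A b U x"
  shows "\<exists>l. gradient U x = transpose A *v l"
proof -
  define S where "S = range (\<lambda>l. transpose A *v l)"
  have "subspace S"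
    unfolding S_def by (intro linear_subspace_image matrix_vector_mul_linear subspace_UNIV)
  then have span: "span S = S"
    by (simp add: span_eq_iff)
  obtain y z where y: "y \<in> S" and z: "\<And>w. w \<in> S \<Longrightarrow> orthogonal z w"
    and split: "gradient U x = y + z"
    using orthogonal_subspace_decomp_exists[of S "gradient U x"] span by metis
  have "(A *v z) \<bullet> (A *v z) = (transpose A *v (A *v z)) \<bullet> z"
    by (rule inner_matrix_vector_transpose)
  also have "\<dots> = 0"
    using z[of "transpose A *v (A *v z)"] by (simp add: S_def orthogonal_def inner_commute)
  finally have kernel: "A *v z = 0" by simp
  have Ax: "A *v x = b" and max: "\<And>w. A *v w = b \<Longrightarrow> objective U w \<le> objective U x"
    using opt by (auto simp: primal_optimal_def is_arg_max_linorder)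
  have "A *v (x + t *\<^sub>R z) = b" for t
    using kernel Ax
    by (simp add: matrix_vector_right_distrib matrix_vector_mult_scaleR)
  then have "objective U (x + t *\<^sub>R z) \<le> objective U (x + 0 *\<^sub>R z)" for t
    using max by simp
  then have "gradient U x \<bullet> z = 0"
    using DERIV_local_max[OF objective_has_directional_derivative
        [where U = U and x = x and v = z, OF diff] zero_less_one]
    by simp
  moreover have "y \<bullet> z = 0"
    using z[OF y] by (simp add: orthogonal_def inner_commute)
  ultimately have "z = 0"
    by (simp add: split inner_add_left)
  then show ?thesis
    using y split by (auto simp: S_def)
qed

lemma lagrangian_maximal_if_stationary:
  fixes A :: "real^'m^'n"
  assumes "\<And>i. concave_on UNIV (U i)" and "\<And>i t. U i differentiable (at t)"
    and "gradient U x = transpose A *v l"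
  shows "lagrangian A b U z l \<le> lagrangian A b U x l"
proof -
  have "objective U z \<le> objective U x + l \<bullet> (A *v (z - x))"
    using objective_le_tangent[where U = U and x = x and z = z, OF assms(1,2)] assms(3)
    by (simp add: inner_matrix_vector_transpose)
  then show ?thesis
    by (simp add: lagrangian_def matrix_vector_mult_diff_distrib inner_diff_right)
qed

lemma stationary_if_lagrangian_maximal:
  fixes A :: "real^'m^'n"
  assumes diff: "\<And>i t. U i differentiable (at t)"
    and max: "\<And>z. lagrangian A b U z l \<le> lagrangian A b U x l"
  shows "gradient U x = transpose A *v l"
proof -
  \<comment> \<open>The gradient of the Lagrangian in its first argument: moving along it would increase the
    Lagrangian unless it vanishes.\<close>
  define v where "v = gradient U x - transpose A *v l"
  have lag: "lagrangian A b U (x + t *\<^sub>R v) l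
      = objective U (x + t *\<^sub>R v) - l \<bullet> (A *v x - b) - t * ((transpose A *v l) \<bullet> v)" for t
    by (simp add: lagrangian_def matrix_vector_right_distrib matrix_vector_mult_scaleR
        inner_matrix_vector_transpose inner_diff_right inner_add_right)
  have "((\<lambda>t. lagrangian A b U (x + t *\<^sub>R v) l) has_real_derivative
      gradient U x \<bullet> v - (transpose A *v l) \<bullet> v) (at 0)"
    unfolding lag
    using objective_has_directional_derivative[where U = U and x = x and v = v, OF diff]
    by (auto intro!: derivative_eq_intros)
  then have "gradient U x \<bullet> v - (transpose A *v l) \<bullet> v = 0"
    by (rule DERIV_local_max[OF _ zero_less_one]) (simp add: max)
  then have "v \<bullet> v = 0"
    by (simp add: v_def inner_diff_left)
  then show ?thesis by (simp add: v_def)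
qed

text \<open>Strong duality is what turns separate optimality of \<open>x\<close> and \<open>l\<close> into the joint first-order
  condition: the dual value at \<open>l\<close> is at most the one at a multiplier of \<open>x\<close>, which is the primal
  value, and this in turn is the value of the Lagrangian at \<open>(x, l)\<close>.\<close>

lemma optimal_pair_stationary:
  fixes A :: "real^'m^'n"
  assumes concave: "\<And>i. concave_on UNIV (U i)"
    and diff: "\<And>i t. U i differentiable (at t)"
    and primal: "primal_optimal A b U x" and dual: "dual_optimal A b U l"
  shows "A *v x = b" and "gradient U x = transpose A *v l"
proof -
  show Ax: "A *v x = b"
    using primal by (auto simp: primal_optimal_def is_arg_max_linorder)
  then have lagr: "lagrangian A b U x l' = objective U x" for l'
    by (simp add: lagrangian_def)
  obtain l' where l': "gradient U x = transpose A *v l'"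
    using lagrange_multiplier_exists[OF diff primal] by blast
  have "lagrangian A b U z l \<le> lagrangian A b U x l" for z
  proof -
    have "ereal (lagrangian A b U z l) \<le> dual_function A b U l"
      unfolding dual_function_def by (rule SUP_upper) simp
    also have "\<dots> \<le> dual_function A b U l'"
      using dual by (simp add: dual_optimal_def is_arg_min_linorder)
    also have "\<dots> \<le> ereal (lagrangian A b U x l')"
      unfolding dual_function_def
      by (rule SUP_least) (simp add: lagrangian_maximal_if_stationary[OF concave diff l'])
    finally show ?thesis by (simp add: lagr)
  qed
  then show "gradient U x = transpose A *v l"
    by (rule stationary_if_lagrangian_maximal[OF diff])
qed

lemma pd_step_eq:
  fixes A :: "real^'m^'n"
  shows "pd_step A b U \<mu> (x, l)
    = (x + \<mu> *\<^sub>R (gradient U x - transpose A *v l), l + \<mu> *\<^sub>R (A *v x - b))"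
  by (simp add: pd_step_def primal_update_def dual_update_def gradient_def vec_eq_iff
      matrix_vector_mult_def transpose_def column_def row_def inner_vec_def)

lemma pd_step_fixed_point:
  fixes A :: "real^'m^'n"
  assumes "A *v x = b" and "gradient U x = transpose A *v l"
  shows "pd_step A b U \<mu> (x, l) = (x, l)"
  using assms by (simp add: pd_step_eq)

section \<open>The quantization error\<close>

text \<open>\<open>Q_hat\<close> returns the left end of the unit cell that contains its argument, so adding one half
  gives the midpoint of that cell.\<close>

lemma Q_hat_error:
  assumes "- real_of_int m \<le> z" and "z \<le> real_of_int m"
  shows "\<bar>real_of_int (Q_hat m z) + 1/2 - z\<bar> \<le> 1/2"
proof (cases "z < real_of_int m - 1")
  case True
  then have "Q_hat m z = \<lfloor>z\<rfloor>" using assms by (simp add: Q_hat_def)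
  then show ?thesis by linarith
next
  case False
  then have "Q_hat m z = m - 1" using assms by (simp add: Q_hat_def)
  then show ?thesis using False assms by (simp add: abs_if)
qed

lemma floor_scaled_bounds:
  fixes d t :: real
  assumes "d > 0"
  shows "of_int \<lfloor>t / d\<rfloor> * d \<le> t" and "t < of_int \<lfloor>t / d\<rfloor> * d + d"
proof -
  show "of_int \<lfloor>t / d\<rfloor> * d \<le> t"
    using assms by (metis of_int_floor_le pos_le_divide_eq)
  have "t / d < of_int \<lfloor>t / d\<rfloor> + 1" by linarith
  then show "t < of_int \<lfloor>t / d\<rfloor> * d + d"
    using assms by (simp add: pos_divide_less_eq algebra_simps)
qed

text \<open>The old error of half a cell and the rounding of the innovation by up to one cell add up to at
  most two cells of the old width, that is, \<open>2 / \<alpha>\<close> cells of the new width. So the new value lies in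
  the domain of \<open>Q_hat\<close>, and the error estimate propagates.\<close>

lemma Qa_error:
  assumes "0 < \<alpha>"
  shows "\<bar>Qa \<alpha> v k - v k\<bar> \<le> delta \<alpha> k / 2"
proof (induction k)
  case 0
  have "of_int \<lfloor>v 0 / \<alpha>\<rfloor> * \<alpha> \<le> v 0" and "v 0 < of_int \<lfloor>v 0 / \<alpha>\<rfloor> * \<alpha> + \<alpha>"
    using floor_scaled_bounds[OF assms] by blast+
  then have "\<bar>of_int \<lfloor>v 0 / \<alpha>\<rfloor> * \<alpha> + \<alpha> / 2 - v 0\<bar> \<le> \<alpha> / 2" by linarith
  then show ?case by (simp add: delta_def)
next
  case (Suc k)
  define d where "d = delta \<alpha> k"
  define d' where "d' = delta \<alpha> (Suc k)"
  define C where "C = Qa_center \<alpha> k (Qa \<alpha> v k) (v k) (v (Suc k))"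
  define m where "m = \<lceil>2 / \<alpha>\<rceil>"
  define z where "z = (v (Suc k) - C) / d'"
  have d: "d > 0" "d' > 0" and d': "d' = \<alpha> * d"
    using assms by (simp_all add: d_def d'_def delta_def)
  have "of_int \<lfloor>(v (Suc k) - v k) / d\<rfloor> * d \<le> v (Suc k) - v k"
    and "v (Suc k) - v k < of_int \<lfloor>(v (Suc k) - v k) / d\<rfloor> * d + d"
    using floor_scaled_bounds[OF d(1)] by blast+
  then have "\<bar>v (Suc k) - C\<bar> \<le> 2 * d"
    using Suc.IH unfolding C_def Qa_center_def d_def[symmetric] by linarith
  also have "\<dots> = 2 / \<alpha> * d'"
    using assms by (simp add: d')
  also have "\<dots> \<le> of_int m * d'"
    using d(2) by (intro mult_right_mono) (simp_all add: m_def)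
  finally have "\<bar>z\<bar> \<le> of_int m"
    using d(2) by (simp add: z_def abs_divide pos_divide_le_eq)
  then have "\<bar>real_of_int (Q_hat m z) + 1/2 - z\<bar> \<le> 1/2"
    by (intro Q_hat_error) linarith+
  then have "\<bar>real_of_int (Q_hat m z) + 1/2 - z\<bar> * d' \<le> 1/2 * d'"
    using d(2) by (intro mult_right_mono) simp_all
  moreover have "\<bar>real_of_int (Q_hat m z) + 1/2 - z\<bar> * d' = \<bar>Qa \<alpha> v (Suc k) - v (Suc k)\<bar>"
  proof -
    have q: "Qa \<alpha> v (Suc k) = C + of_int (Q_hat m z) * d' + d' / 2"
      by (simp add: C_def d'_def m_def z_def Let_def)
    have v: "v (Suc k) = C + z * d'"
      using d(2) by (simp add: z_def)
    have "Qa \<alpha> v (Suc k) - v (Suc k) = (real_of_int (Q_hat m z) + 1/2 - z) * d'"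
      unfolding q v by (simp add: algebra_simps)
    then show ?thesis
      using d(2) by (simp only: abs_mult abs_of_pos)
  qed
  ultimately show ?case
    unfolding d'_def by linarith
qed

section \<open>Perturbed contractions\<close>

text \<open>At a rate \<open>r\<close> above \<open>\<alpha>\<close> the gap \<open>r - \<alpha>\<close> absorbs the perturbation: the induction step needs
  \<open>\<alpha> * c + C * \<alpha> \<le> r * c\<close>, which holds as soon as \<open>c \<ge> C * \<alpha> / (r - \<alpha>)\<close>.\<close>

lemma perturbed_contraction_exponential:
  fixes a :: "nat \<Rightarrow> real"
  assumes "0 < \<alpha>" and "\<alpha> < r" and "0 \<le> C" and "0 \<le> a 0"
    and step: "\<And>k. a (Suc k) \<le> \<alpha> * a k + C * \<alpha> ^ (k + 1)"
  shows "\<exists>c>0. \<forall>k. a k \<le> c * r ^ k"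
proof -
  define c where "c = a 0 + C * \<alpha> / (r - \<alpha>) + 1"
  have quot: "0 \<le> C * \<alpha> / (r - \<alpha>)" using assms by simp
  have "C * \<alpha> = C * \<alpha> / (r - \<alpha>) * (r - \<alpha>)" using assms by simp
  also have "\<dots> \<le> c * (r - \<alpha>)"
    using assms by (intro mult_right_mono) (auto simp: c_def)
  finally have gap: "\<alpha> * c + C * \<alpha> \<le> r * c" by (simp add: algebra_simps)
  have "a k \<le> c * r ^ k" for k
  proof (induction k)
    case 0
    show ?case using quot by (simp add: c_def)
  next
    case (Suc k)
    have "\<alpha> ^ k \<le> r ^ k" using assms by (intro power_mono) auto
    then have "C * \<alpha> * \<alpha> ^ k \<le> C * \<alpha> * r ^ k" using assms by (intro mult_left_mono) auto
    moreover have "\<alpha> * a k \<le> \<alpha> * (c * r ^ k)" using Suc assms by (intro mult_left_mono) auto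
    ultimately have "a (Suc k) \<le> (\<alpha> * c + C * \<alpha>) * r ^ k"
      using step[of k] by (simp add: algebra_simps)
    also have "\<dots> \<le> r * c * r ^ k" using gap assms by (intro mult_right_mono) auto
    finally show ?case by (simp add: algebra_simps)
  qed
  moreover have "c > 0" using quot assms(4) unfolding c_def by linarith
  ultimately show ?thesis by blast
qed

lemma is_norm_nonneg:
  assumes "is_norm nrm"
  shows "0 \<le> nrm v"
proof -
  have "nrm (v + (-1) *\<^sub>R v) \<le> nrm v + nrm ((-1) *\<^sub>R v)"
    and "nrm ((-1) *\<^sub>R v) = \<bar>-1\<bar> * nrm v" and "nrm 0 = 0"
    using assms unfolding is_norm_def by blast+
  then show ?thesis by simp
qed

text \<open>Coordinatewise errors are all the quantizer controls, so this is the form in which the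
  equivalence of norms enters. The norm is composed with a linear map because that is how the error
  reaches the iterates.\<close>

lemma is_norm_linear_le_coordinates:
  fixes G :: "'a::euclidean_space \<Rightarrow> 'b::real_vector"
  assumes "is_norm nrm" and "linear G"
    and coord: "\<And>u. u \<in> Basis \<Longrightarrow> \<bar>v \<bullet> u\<bar> \<le> \<epsilon>"
  shows "nrm (G v) \<le> (\<Sum>u\<in>Basis. nrm (G u)) * \<epsilon>"
proof -
  have zero: "nrm 0 = 0" and scale: "\<And>c w. nrm (c *\<^sub>R w) = \<bar>c\<bar> * nrm w"
    and triangle: "\<And>w w'. nrm (w + w') \<le> nrm w + nrm w'"
    using assms(1) by (auto simp: is_norm_def)
  have sum_le: "nrm (\<Sum>u\<in>B. f u) \<le> (\<Sum>u\<in>B. nrm (f u))" if "finite B"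
    for B :: "'a set" and f :: "'a \<Rightarrow> 'b"
    using that
  proof (induction B)
    case (insert u B)
    then show ?case using triangle[of "f u" "sum f B"] by simp
  qed (simp add: zero)
  have "G v = G (\<Sum>u\<in>Basis. (v \<bullet> u) *\<^sub>R u)"
    by (simp add: euclidean_representation)
  also have "\<dots> = (\<Sum>u\<in>Basis. (v \<bullet> u) *\<^sub>R G u)"
    by (simp add: linear_sum[OF assms(2)] linear_scale[OF assms(2)])
  finally have "nrm (G v) \<le> (\<Sum>u\<in>Basis. \<bar>v \<bullet> u\<bar> * nrm (G u))"
    using sum_le[of Basis "\<lambda>u. (v \<bullet> u) *\<^sub>R G u"] by (simp add: scale)
  also have "\<dots> \<le> (\<Sum>u\<in>Basis. \<epsilon> * nrm (G u))"
    by (intro sum_mono mult_right_mono coord is_norm_nonneg[OF assms(1)])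
  also have "\<dots> = (\<Sum>u\<in>Basis. nrm (G u)) * \<epsilon>"
    by (simp add: sum_distrib_left mult.commute)
  finally show ?thesis .
qed

section \<open>The quantized iteration as a perturbed contraction\<close>

text \<open>The linear part of the primal-dual update, through which an error in the communicated values
  enters the iteration.\<close>

definition coupling :: "real^'m^'n \<Rightarrow> (real^'m) \<times> (real^'n) \<Rightarrow> (real^'m) \<times> (real^'n)" where
  "coupling A d = (- (transpose A *v snd d), A *v fst d)"

lemma linear_coupling: "linear (coupling A)"
  by (intro linearI)
    (simp_all add: coupling_def matrix_vector_right_distrib matrix_vector_mult_scaleR)

lemma quantized_update_eq_pd_step_plus_error:
  fixes A :: "real^'m^'n"
  shows "(primal_update A U \<mu> x ql, dual_update A b \<mu> l qx)
    = pd_step A b U \<mu> (x, l) + \<mu> *\<^sub>R coupling A (qx - x, ql - l)"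
  unfolding pd_step_eq
  by (simp add: primal_update_def dual_update_def gradient_def coupling_def vec_eq_iff
      algebra_simps)
    (simp add: matrix_vector_mult_def vector_matrix_mult_def column_def row_def inner_vec_def
      mult.commute)

lemma Qa_vec_error_coordinates:
  fixes x :: "nat \<Rightarrow> real^'m" and l :: "nat \<Rightarrow> real^'n"
  assumes "0 < \<alpha>" and "u \<in> Basis"
  shows "\<bar>(Qa_vec \<alpha> x k - x k, Qa_vec \<alpha> l k - l k) \<bullet> u\<bar> \<le> delta \<alpha> k / 2"
proof -
  have "\<bar>(Qa_vec \<alpha> w k - w k) $ i\<bar> \<le> delta \<alpha> k / 2" for w :: "nat \<Rightarrow> real^'d" and i
    using Qa_error[OF assms(1), of "\<lambda>t. w t $ i" k] by (simp add: Qa_vec_def)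
  note err = this[of x] this[of l]
  from assms(2) show ?thesis
    using err by (auto simp: Basis_prod_def Basis_vec_def inner_axis)
qed

theorem theorem5:
  fixes A :: "real^'m^'n" and b :: "real^'n"
    and U :: "'m \<Rightarrow> real \<Rightarrow> real" and Umin Umax :: "'m \<Rightarrow> real"
    and \<mu> :: "nat \<Rightarrow> real" and \<mu>star \<alpha> :: real
    and nrm :: "(real^'m) \<times> (real^'n) \<Rightarrow> real"
    and L :: nat
    and x :: "nat \<Rightarrow> real^'m" and l :: "nat \<Rightarrow> real^'n"
    and xstar :: "real^'m" and lstar :: "real^'n"
  assumes "CARD('n) < CARD('m)"
    and "\<And>i. concave_on UNIV (U i)"
    and "\<And>i. twice_continuously_differentiable (U i)"
    and "\<And>i t. Umin i \<le> deriv (deriv (U i)) t"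
    and "\<And>i t. deriv (deriv (U i)) t \<le> Umax i"
    and "\<And>i. Umax i < 0"
    and "\<And>k. 0 < \<mu> k"
    and "\<And>k. \<mu> k \<le> (MIN i. 1 / \<bar>Umin i\<bar>)"
    and "\<mu> \<longlonglongrightarrow> \<mu>star" and "\<mu>star > 0"
    and "is_norm nrm" and "0 < \<alpha>" and "\<alpha> < 1"
    and "\<And>k y z. nrm (pd_step A b U (\<mu> k) y - pd_step A b U (\<mu> k) z) \<le> \<alpha> * nrm (y - z)"
    and "primal_optimal A b U xstar" and "dual_optimal A b U lstar"
    and "L > 0"
    and "\<And>i. x 0 $ i \<in> {- (real L * \<alpha>)<..<real L * \<alpha>}"
    and "\<And>j. l 0 $ j \<in> {- (real L * \<alpha>)<..<real L * \<alpha>}"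
    and "\<And>k. x (Suc k) = primal_update A U (\<mu> k) (x k) (Qa_vec \<alpha> l k)"
    and "\<And>k. l (Suc k) = dual_update A b (\<mu> k) (l k) (Qa_vec \<alpha> x k)"
  shows "\<exists>c r. c > 0 \<and> 0 < r \<and> r < 1 \<and>
           (\<forall>k. nrm ((x k, l k) - (xstar, lstar)) \<le> c * r ^ k)"
proof -
  have diff: "U i differentiable (at t)" for i t
    using assms(3)[of i] by (simp add: twice_continuously_differentiable_def)
  have fixed: "pd_step A b U (\<mu> k) (xstar, lstar) = (xstar, lstar)" for k
    using optimal_pair_stationary[OF assms(2) diff assms(15,16)] by (rule pd_step_fixed_point)
  define B where "B = (MIN i. 1 / \<bar>Umin i\<bar>)"
  define K where "K = (\<Sum>u\<in>Basis. nrm (coupling A u))"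
  define a where "a k = nrm ((x k, l k) - (xstar, lstar))" for k
  have nonneg: "0 \<le> nrm y" for y by (rule is_norm_nonneg[OF assms(11)])
  have \<mu>: "0 < \<mu> k" "\<mu> k \<le> B" for k using assms(7,8) by (simp_all add: B_def)
  have "0 < B" using \<mu>[of 0] by linarith
  have "0 \<le> K" unfolding K_def by (intro sum_nonneg nonneg)
  have step: "a (Suc k) \<le> \<alpha> * a k + (B * K / 2) * \<alpha> ^ (k + 1)" for k
  proof -
    define d where "d = (Qa_vec \<alpha> x k - x k, Qa_vec \<alpha> l k - l k)"
    have "(x (Suc k), l (Suc k)) - (xstar, lstar)
        = (pd_step A b U (\<mu> k) (x k, l k) - pd_step A b U (\<mu> k) (xstar, lstar))
          + \<mu> k *\<^sub>R coupling A d"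
      unfolding assms(20)[of k] assms(21)[of k] quantized_update_eq_pd_step_plus_error fixed d_def
      by simp
    moreover have "nrm (v + \<mu> k *\<^sub>R w) \<le> nrm v + \<mu> k * nrm w" for v w
    proof -
      have "nrm (v + \<mu> k *\<^sub>R w) \<le> nrm v + nrm (\<mu> k *\<^sub>R w)"
        and "nrm (\<mu> k *\<^sub>R w) = \<bar>\<mu> k\<bar> * nrm w"
        using assms(11) unfolding is_norm_def by blast+
      then show ?thesis using \<mu>(1)[of k] by simp
    qed
    ultimately have "a (Suc k)
        \<le> nrm (pd_step A b U (\<mu> k) (x k, l k) - pd_step A b U (\<mu> k) (xstar, lstar))
          + \<mu> k * nrm (coupling A d)"
      by (simp only: a_def)
    moreover have "nrm (pd_step A b U (\<mu> k) (x k, l k) - pd_step A b U (\<mu> k) (xstar, lstar))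
        \<le> \<alpha> * a k"
      unfolding a_def by (rule assms(14))
    moreover have "\<mu> k * nrm (coupling A d) \<le> B * (K * (delta \<alpha> k / 2))"
    proof (rule mult_mono)
      show "nrm (coupling A d) \<le> K * (delta \<alpha> k / 2)"
        unfolding K_def d_def
        by (intro is_norm_linear_le_coordinates assms(11) linear_coupling
            Qa_vec_error_coordinates assms(12))
    qed (use \<mu> \<open>0 < B\<close> nonneg in auto)
    ultimately show ?thesis by (simp add: delta_def)
  qed
  \<comment> \<open>Every rate strictly between \<open>\<alpha>\<close> and \<open>1\<close> would do.\<close>
  define r where "r = (1 + \<alpha>) / 2"
  have r: "\<alpha> < r" "0 < r" "r < 1" using assms(12,13) by (simp_all add: r_def)
  have "0 \<le> B * K / 2" using \<open>0 < B\<close> \<open>0 \<le> K\<close> by simp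
  moreover have "0 \<le> a 0" unfolding a_def by (rule nonneg)
  ultimately obtain c where "c > 0" "\<forall>k. a k \<le> c * r ^ k"
    using perturbed_contraction_exponential[of \<alpha> r _ a, OF assms(12) r(1) _ _ step] by blast
  then show ?thesis using r unfolding a_def by blast
qed

end
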